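(* For $n$ players and $2$ transmission channels, there exists an anonymous, history-dependent equilibrium protocol with ternary feedback.
   Context: Contention game: $n$ players, channel set $K=\{1,\dots,k\}$ (here $k=2$), discrete slots $t=1,2,\dots$; each player has one packet and is initially pending. In each slot a pending player chooses (possibly at random) an action in $\{0,1,\dots,k\}$ ($0$ = no transmission, $a$ = transmit on channel $a$). A lone transmitter on a channel succeeds and leaves; two or more transmitters on a channel collide and remain pending. Latency $T_i$ = slot of player $i$'s successful transmission; players minimize expected latency. Ternary feedback: in every slot every pending player is informed of the current number $m\le n$ of pending players, regardless of her own transmission history; decision rules may depend on this and on the player's personal history. An anonymous protocol is a common protocol whose decision rules do not depend on the player's identity; it is an equilibrium protocol if, when all players use it, no player at any slot and after any history can decrease her conditional expected latency by unilaterally deviating. *)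

theory Defs
  imports "HOL-Probability.Probability"
begin

text \<open>Contention game with n players and channels 1..k, ternary feedback.
  Players are indexed by naturals j < n.  A personal history is the list of
  pairs (m, a): number m of pending players observed in a past slot and the
  action a taken there (0 = silent, c = transmit on channel c).
  A decision rule maps (personal history, current number of pending players)
  to a distribution over actions.\<close>

type_synonym hist = "(nat \<times> nat) list"
type_synonym rule = "hist \<Rightarrow> nat \<Rightarrow> nat pmf"
type_synonym gstate = "nat \<Rightarrow> hist option"
  (* None = not pending (already succeeded or not a player); Some h = pending with history h *)

definition pending :: "nat \<Rightarrow> gstate \<Rightarrow> nat set" where
  "pending n f = {j. j < n \<and> f j \<noteq> None}"

definition valid_rule :: "nat \<Rightarrow> rule \<Rightarrow> bool" where
  "valid_rule k r \<longleftrightarrow> (\<forall>h m. set_pmf (r h m) \<subseteq> {0..k})"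

definition step :: "nat \<Rightarrow> (nat \<Rightarrow> rule) \<Rightarrow> gstate \<Rightarrow> gstate pmf" where
  "step n \<sigma> f =
     (let A = pending n f; m = card A in
      map_pmf
        (\<lambda>a j. if j \<in> A then
                 (if a j \<noteq> 0 \<and> (\<forall>j'\<in>A. j' \<noteq> j \<longrightarrow> a j' \<noteq> a j) then None
                  else Some (the (f j) @ [(m, a j)]))
               else None)
        (Pi_pmf A 0 (\<lambda>j. \<sigma> j (the (f j)) m)))"

fun run :: "nat \<Rightarrow> (nat \<Rightarrow> rule) \<Rightarrow> nat \<Rightarrow> gstate \<Rightarrow> gstate pmf" where
  "run n \<sigma> 0 f = return_pmf f"
| "run n \<sigma> (Suc t) f = bind_pmf (run n \<sigma> t f) (step n \<sigma>)"

definition init_state :: "nat \<Rightarrow> gstate" where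
  "init_state n = (\<lambda>j. if j < n then Some [] else None)"

text \<open>Expected number of remaining slots (current slot included) until player i
  succeeds, starting from global state f: sum over u of P(still pending after u slots).\<close>
definition exp_remaining :: "nat \<Rightarrow> (nat \<Rightarrow> rule) \<Rightarrow> nat \<Rightarrow> gstate \<Rightarrow> ennreal" where
  "exp_remaining n \<sigma> i f = (\<Sum>u. ennreal (measure_pmf.prob (run n \<sigma> u f) {g. g i \<noteq> None}))"

definition replay :: "hist \<Rightarrow> rule" where
  "replay h = (\<lambda>h' m. return_pmf (if length h' < length h then snd (h ! length h') else 0))"

definition info_event :: "nat \<Rightarrow> nat \<Rightarrow> hist \<Rightarrow> nat \<Rightarrow> gstate set" where
  "info_event n i h m = {f. f i = Some h \<and> card (pending n f) = m}"

definition reach_dist :: "nat \<Rightarrow> rule \<Rightarrow> nat \<Rightarrow> hist \<Rightarrow> gstate pmf" where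
  "reach_dist n P i h = run n ((\<lambda>j. P)(i := replay h)) (length h) (init_state n)"

definition cond_exp_latency :: "nat \<Rightarrow> rule \<Rightarrow> nat \<Rightarrow> hist \<Rightarrow> nat \<Rightarrow> rule \<Rightarrow> ennreal" where
  "cond_exp_latency n P i h m \<tau> =
     (\<integral>\<^sup>+ f. indicator (info_event n i h m) f *
              (of_nat (length h) + exp_remaining n ((\<lambda>j. P)(i := \<tau>)) i f)
        \<partial>measure_pmf (reach_dist n P i h))
     / ennreal (measure_pmf.prob (reach_dist n P i h) (info_event n i h m))"

definition equilibrium_protocol :: "nat \<Rightarrow> nat \<Rightarrow> rule \<Rightarrow> bool" where
  "equilibrium_protocol k n P \<longleftrightarrow>
     valid_rule k P \<and>
     (\<forall>i<n. \<forall>h m.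
        measure_pmf.prob (reach_dist n P i h) (info_event n i h m) > 0 \<longrightarrow>
        (\<forall>\<tau>. valid_rule k \<tau> \<longrightarrow> cond_exp_latency n P i h m P \<le> cond_exp_latency n P i h m \<tau>))"

end

theory Submission
  imports Defs
begin

text \<open>The protocol is memoryless: with \<open>m\<close> pending players, transmit with probability \<open>p m\<close>, on a
  uniformly chosen channel. Both channels then look alike to a player, so one slot offers only two
  essentially different actions, silence and transmission. Given the values with fewer pending
  players, the intermediate value theorem yields a \<open>p m\<close> at which either the player is
  indifferent, or \<open>p m = 1\<close> and transmission is at least as good as silence. The resulting values
  \<open>V m\<close> satisfy the Bellman equation along the protocol and the Bellman inequality for every
  deviation, from every global state and not just on average over an information set. Since \<open>V\<close>
  is bounded on the states that occur, a telescoping argument finishes the proof.\<close>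

section \<open>The symmetric mixed action and the cost of a single slot\<close>

definition action_pmf :: "real \<Rightarrow> nat pmf" where
  "action_pmf p = bind_pmf (bernoulli_pmf p) (\<lambda>b. if b then pmf_of_set {1, 2} else return_pmf 0)"

text \<open>Below, \<open>B\<close> is the set of the other pending players, \<open>y\<close> their actions, and \<open>a\<close> the action
  of the player under consideration.\<close>

definition blocked :: "nat set \<Rightarrow> nat \<Rightarrow> (nat \<Rightarrow> nat) \<Rightarrow> bool" where
  "blocked B a y \<longleftrightarrow> a = 0 \<or> (\<exists>j\<in>B. y j = a)"

text \<open>For \<open>a = 0\<close> the disjunct \<open>y j = a\<close> merely repeats
  \<open>y j = 0\<close>, so a silent player and a transmitting one are treated by one
  formula.\<close>

definition remaining :: "nat set \<Rightarrow> nat \<Rightarrow> (nat \<Rightarrow> nat) \<Rightarrow> nat set" where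
  "remaining B a y = {j\<in>B. y j = 0 \<or> y j = a \<or> (\<exists>j'\<in>B. j' \<noteq> j \<and> y j' = y j)}"

text \<open>\<open>Suc\<close> counts the player herself, who is still pending exactly when she is
  blocked.\<close>

definition future_cost :: "(nat \<Rightarrow> real) \<Rightarrow> nat set \<Rightarrow> nat \<Rightarrow> (nat \<Rightarrow> nat) \<Rightarrow> real" where
  "future_cost v B a y = (if blocked B a y then v (Suc (card (remaining B a y))) else 0)"

definition action_cost :: "(nat \<Rightarrow> real) \<Rightarrow> nat set \<Rightarrow> real \<Rightarrow> nat \<Rightarrow> real" where
  "action_cost v B p a =
     1 + measure_pmf.expectation (Pi_pmf B 0 (\<lambda>_. action_pmf p)) (future_cost v B a)"

lemma pmf_action_pmf:
  assumes "0 \<le> p" "p \<le> 1"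
  shows "pmf (action_pmf p) a = (if a = 0 then 1 - p else if a = 1 \<or> a = 2 then p / 2 else 0)"
  using assms by (auto simp: action_pmf_def pmf_bind pmf_of_set indicator_def)

lemma set_action_pmf: "set_pmf (action_pmf p) \<subseteq> {0, 1, 2}"
  by (auto simp: action_pmf_def set_pmf_of_set split: if_splits)

lemma action_pmf_1: "0 \<notin> set_pmf (action_pmf 1)"
  by (simp add: set_pmf_iff pmf_action_pmf)

lemma action_pmf_0: "action_pmf 0 = return_pmf 0"
  by (rule pmf_eqI) (simp add: pmf_action_pmf indicator_def)

lemma finite_set_profiles:
  "finite B \<Longrightarrow> finite (set_pmf (Pi_pmf B 0 (\<lambda>_. action_pmf p)))"
  by (rule finite_subset[OF set_Pi_pmf_subset'])
     (auto intro!: finite_PiE_dflt finite_subset[OF set_action_pmf])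

text \<open>On \<open>{0..1}\<close> the expectation is a polynomial in \<open>p\<close>: one finite
  set of profiles serves for all \<open>p\<close>, and the probability of each profile is a product
  of factors \<open>1 - p\<close> and \<open>p / 2\<close>.\<close>

lemma continuous_on_profile_expectation:
  fixes g :: "(nat \<Rightarrow> nat) \<Rightarrow> real"
  assumes "finite B"
  shows "continuous_on {0..1}
           (\<lambda>p. measure_pmf.expectation (Pi_pmf B 0 (\<lambda>_. action_pmf p)) g)"
proof -
  define S where "S = PiE_dflt B 0 (\<lambda>_. {0::nat, 1, 2})"
  have S: "finite S"
    unfolding S_def using assms by auto
  have "measure_pmf.expectation (Pi_pmf B 0 (\<lambda>_. action_pmf p)) g =
     (\<Sum>y\<in>S. g y * (\<Prod>j\<in>B. if y j = 0 then 1 - p else if y j = 1 \<or> y j = 2 then p / 2 else 0))"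
    if p: "p \<in> {0..1}" for p
  proof -
    have "measure_pmf.expectation (Pi_pmf B 0 (\<lambda>_. action_pmf p)) g =
       (\<Sum>y\<in>S. g y * pmf (Pi_pmf B 0 (\<lambda>_. action_pmf p)) y)"
    proof (rule integral_measure_pmf_real[OF S])
      fix y assume "y \<in> set_pmf (Pi_pmf B 0 (\<lambda>_. action_pmf p))"
      then show "y \<in> S"
        using set_Pi_pmf_subset'[OF assms] set_action_pmf
        unfolding S_def PiE_dflt_def by fastforce
    qed
    also have "\<dots> = (\<Sum>y\<in>S. g y * (\<Prod>j\<in>B. pmf (action_pmf p) (y j)))"
      by (intro sum.cong refl arg_cong2[where f = "(*)"] pmf_Pi' assms)
         (auto simp: S_def PiE_dflt_def)
    finally show ?thesis
      using p by (simp add: pmf_action_pmf)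
  qed
  moreover have "continuous_on {0..1}
     (\<lambda>p::real. if a = 0 then 1 - p else if a = 1 \<or> a = 2 then p / 2 else 0)" for a :: nat
    by (cases "a = 0"; cases "a = 1 \<or> a = 2") (auto intro!: continuous_intros)
  then have "continuous_on {0..1}
     (\<lambda>p::real. \<Sum>y\<in>S. g y * (\<Prod>j\<in>B. if y j = 0 then 1 - p else if y j = 1 \<or> y j = 2 then p / 2 else 0))"
    by (intro continuous_intros)
  ultimately show ?thesis
    by (subst continuous_on_cong[OF refl]) auto
qed

section \<open>Invariances of the one-slot cost\<close>

text \<open>The players left over form a subset of \<open>B\<close>, so \<open>v\<close> is never
  read beyond \<open>Suc (card B)\<close>. This later replaces a function truncated at the current
  number of players by the full value function.\<close>

lemma action_cost_cong:
  assumes "finite B" "\<And>c. c \<le> Suc (card B) \<Longrightarrow> v c = w c"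
  shows "action_cost v B p a = action_cost w B p a"
proof -
  have "card (remaining B a y) \<le> card B" for y
    unfolding remaining_def using assms(1) by (intro card_mono) auto
  then have "future_cost v B a = future_cost w B a"
    using assms(2) by (auto simp: future_cost_def fun_eq_iff)
  then show ?thesis
    by (simp add: action_cost_def)
qed

text \<open>Exchanging the two channels preserves the law of the opponents' actions and turns the
  future cost of channel 2 into that of channel 1.\<close>

lemma action_cost_channel_sym:
  assumes "finite B"
  shows "action_cost v B p 2 = action_cost v B p 1"
proof -
  define s :: "nat \<Rightarrow> nat" where "s = (\<lambda>a. if a = 1 then 2 else if a = 2 then 1 else a)"
  have [simp]: "s x = 0 \<longleftrightarrow> x = 0" "s x = s y \<longleftrightarrow> x = y" "s x = 2 \<longleftrightarrow> x = 1" "s 0 = 0" for x y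
    by (auto simp: s_def)
  have "map_pmf s (pmf_of_set {1, 2}) = pmf_of_set (s ` {1, 2})"
    by (rule map_pmf_of_set_inj) (auto simp: inj_on_def)
  also have "s ` {1, 2} = {1, 2}"
    by (auto simp: s_def)
  finally have "action_pmf p = map_pmf s (action_pmf p)"
    by (auto simp: action_pmf_def map_bind_pmf intro!: bind_pmf_cong)
  then have "Pi_pmf B 0 (\<lambda>_. action_pmf p) = map_pmf (\<lambda>y. s \<circ> y) (Pi_pmf B 0 (\<lambda>_. action_pmf p))"
    using Pi_pmf_map[of B s 0 0 "\<lambda>_. action_pmf p"] assms by simp
  then have "measure_pmf.expectation (Pi_pmf B 0 (\<lambda>_. action_pmf p)) (future_cost v B 2) =
    measure_pmf.expectation (map_pmf (\<lambda>y. s \<circ> y) (Pi_pmf B 0 (\<lambda>_. action_pmf p))) (future_cost v B 2)"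
    by simp
  also have "\<dots> = measure_pmf.expectation (Pi_pmf B 0 (\<lambda>_. action_pmf p)) (\<lambda>y. future_cost v B 2 (s \<circ> y))"
    by simp
  also have "(\<lambda>y. future_cost v B 2 (s \<circ> y)) = future_cost v B 1"
    by (simp add: fun_eq_iff future_cost_def blocked_def remaining_def)
  finally show ?thesis
    by (simp add: action_cost_def)
qed

text \<open>The opponents act independently with the same law, so relabelling them along a bijection
  changes nothing. A stage solved for one set of opponents is thereby solved for all sets of that
  size.\<close>

lemma action_cost_card:
  assumes "finite B" "finite C" "card B = card C"
  shows "action_cost v B p a = action_cost v C p a"
proof -
  obtain h0 where h0: "bij_betw h0 B C"
    using assms finite_same_card_bij by blast
  obtain z where z: "z \<notin> C"
    using assms(2) ex_new_if_finite infinite_UNIV_nat by blast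
  \<comment> \<open>Points outside \<open>B\<close> go to some \<open>z\<close> outside
    \<open>C\<close>, so that \<open>y \<circ> h\<close> takes the default action 0 there, as the
    product measure over \<open>B\<close> demands.\<close>
  define h where "h = (\<lambda>x. if x \<in> B then h0 x else z)"
  have h: "bij_betw h B C"
    using h0 by (subst bij_betw_cong[of _ _ h0]) (auto simp: h_def)
  have hinj: "h i = h j \<longleftrightarrow> i = j" if "i \<in> B" "j \<in> B" for i j
    using h that by (auto simp: bij_betw_def inj_on_def)
  have him: "C = h ` B"
    using h by (auto simp: bij_betw_def)
  have "Pi_pmf B 0 (\<lambda>_. action_pmf p) = map_pmf (\<lambda>y. y \<circ> h) (Pi_pmf C 0 (\<lambda>_. action_pmf p))"
    using h z by (intro Pi_pmf_bij_betw assms) (auto simp: h_def)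
  moreover have "future_cost v B a (y \<circ> h) = future_cost v C a y" for y
  proof -
    have "remaining C a y = h ` remaining B a (y \<circ> h)"
      unfolding remaining_def him using hinj by auto
    moreover have "inj_on h (remaining B a (y \<circ> h))"
      using hinj by (auto simp: inj_on_def remaining_def)
    ultimately have "card (remaining C a y) = card (remaining B a (y \<circ> h))"
      by (simp add: card_image)
    then show ?thesis
      by (simp add: future_cost_def blocked_def him)
  qed
  ultimately show ?thesis
    by (simp add: action_cost_def)
qed

section \<open>Equilibrium of one stage, and the recursion over the number of pending
  players\<close>

text \<open>If nobody leaves, the same stage is played again, so the continuation value at
  \<open>Suc (card B)\<close> is the unknown \<open>r\<close> itself. Hence \<open>r\<close> is a
  fixed point and has to be found together with \<open>p\<close>; only the values for fewer players
  are given.\<close>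

lemma ex_stage_equilibrium:
  assumes B: "finite B" and v: "\<And>c. c < Suc (card B) \<Longrightarrow> 0 \<le> v c"
  shows "\<exists>r p. 0 \<le> r \<and> (\<forall>a\<in>{0, 1, 2}.
     r \<le> action_cost (\<lambda>c. if c < Suc (card B) then v c else r) B p a \<and>
     (a \<in> set_pmf (action_pmf p) \<longrightarrow>
       action_cost (\<lambda>c. if c < Suc (card B) then v c else r) B p a = r))"
proof -
  define m where "m = Suc (card B)"
  define w where "w = (\<lambda>r c. if c < m then v c else r)"
  define E where "E = (\<lambda>p (g :: _ \<Rightarrow> real). measure_pmf.expectation (Pi_pmf B 0 (\<lambda>_. action_pmf p)) g)"
  \<comment> \<open>\<open>K a\<close> indicates that nobody leaves. Its expectation is the slope of
    the cost as an affine function of \<open>r\<close>, as \<open>split\<close> records.\<close>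
  define K where "K = (\<lambda>a y. of_bool (blocked B a y \<and> Suc (card (remaining B a y)) = m) :: real)"
  have le: "card (remaining B a y) \<le> card B" for a y
    unfolding remaining_def using B by (intro card_mono) auto
  have int: "integrable (measure_pmf (Pi_pmf B 0 (\<lambda>_. action_pmf p))) g" for p and g :: "_ \<Rightarrow> real"
    by (intro integrable_measure_pmf_finite finite_set_profiles B)
  have cont: "continuous_on {0..1} (\<lambda>p. E p g)" for g :: "_ \<Rightarrow> real"
    unfolding E_def by (rule continuous_on_profile_expectation[OF B])
  have split: "action_cost (w r) B p a = 1 + E p (future_cost (w 0) B a) + r * E p (K a)" for r p a
  proof -
    have "future_cost (w r) B a y = future_cost (w 0) B a y + r * K a y" for y
      using le[of a y] by (auto simp: future_cost_def w_def K_def m_def)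
    then have "future_cost (w r) B a = (\<lambda>y. future_cost (w 0) B a y + r * K a y)"
      by (simp add: fun_eq_iff)
    then show ?thesis
      by (simp add: action_cost_def E_def int)
  qed
  \<comment> \<open>It suffices to find one profile of positive probability that leaves channel 1
    free: all opponents silent if \<open>p = 0\<close>, all on channel 2 otherwise. The denominator
    of \<open>U\<close> below is therefore positive.\<close>
  have b_less: "E p (K 1) < 1" if p: "0 \<le> p" "p \<le> 1" for p
  proof -
    define c where "c = (if p = 0 then 0 else 2::nat)"
    define y0 where "y0 = (\<lambda>j. if j \<in> B then c else 0)"
    have "c \<in> set_pmf (action_pmf p)"
      using p by (simp add: c_def set_pmf_iff pmf_action_pmf)
    then have "y0 \<in> set_pmf (Pi_pmf B 0 (\<lambda>_. action_pmf p))"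
      using B by (auto simp: set_Pi_pmf PiE_dflt_def y0_def)
    then have "0 < pmf (Pi_pmf B 0 (\<lambda>_. action_pmf p)) y0"
      by (rule pmf_positive)
    also have "\<dots> = E p (indicator {y0})"
      by (simp add: E_def pmf.rep_eq)
    also have "\<dots> \<le> E p (\<lambda>y. 1 - K 1 y)"
      unfolding E_def
      by (intro integral_mono int)
         (auto simp: K_def indicator_def blocked_def y0_def c_def split: if_splits)
    also have "\<dots> = 1 - E p (K 1)"
      unfolding E_def by (subst Bochner_Integration.integral_diff) (auto simp: int)
    finally show ?thesis by simp
  qed
  txt \<open>\<open>U p\<close> is the value for which transmitting is worth exactly \<open>U p\<close> against opponents who
    transmit with probability \<open>p\<close>; solving for it this way keeps \<open>U\<close> continuous at \<open>p = 0\<close>.\<close>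
  define U where "U = (\<lambda>p. (1 + E p (future_cost (w 0) B 1)) / (1 - E p (K 1)))"
  define F where "F = (\<lambda>p. action_cost (w (U p)) B p 0 - U p)"
  have U: "action_cost (w (U p)) B p 1 = U p" if "0 \<le> p" "p \<le> 1" for p
    using b_less[OF that] unfolding split U_def by (simp add: field_simps)
  have U_nonneg: "0 \<le> U p" if "0 \<le> p" "p \<le> 1" for p
  proof -
    have "0 \<le> E p (future_cost (w 0) B 1)"
      unfolding E_def by (rule Bochner_Integration.integral_nonneg) (auto simp: future_cost_def w_def v m_def)
    then show ?thesis
      using b_less[OF that] by (simp add: U_def)
  qed
  have "continuous_on {0..1} U"
    unfolding U_def using b_less by (intro continuous_intros cont) force
  then have F_cont: "continuous_on {0..1} F"
    unfolding F_def split by (intro continuous_intros cont)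
  \<comment> \<open>Against silent opponents, silence wastes one slot and reproduces the same stage,
    so it costs \<open>1 + U 0\<close>.\<close>
  have "F 0 = 1"
  proof -
    have "remaining B 0 (\<lambda>_. 0) = B"
      by (auto simp: remaining_def)
    then show ?thesis
      using B by (simp add: F_def action_cost_def action_pmf_0 future_cost_def blocked_def w_def m_def)
  qed
  \<comment> \<open>Either \<open>F\<close> changes sign between 0 and 1 and a zero gives
    indifference, or \<open>0 \<le> F 1\<close>. In the latter case \<open>p = 1\<close> works,
    because silence then has probability 0 and only has to be no better than transmission.\<close>
  have "\<exists>p\<in>{0..1}. 0 \<le> F p \<and> (p = 1 \<or> F p = 0)"
  proof (cases "0 \<le> F 1")
    case False
    then obtain x where "0 \<le> x" "x \<le> 1" "F x = 0"
      using IVT2'[of F 1 0 0] F_cont \<open>F 0 = 1\<close> by auto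
    then show ?thesis
      by (intro bexI[of _ x]) auto
  qed auto
  then obtain p where p: "0 \<le> p" "p \<le> 1" "0 \<le> F p" "p = 1 \<or> F p = 0"
    by (meson atLeastAtMost_iff)
  have "\<forall>a\<in>{0, 1, 2}. U p \<le> action_cost (w (U p)) B p a \<and>
          (a \<in> set_pmf (action_pmf p) \<longrightarrow> action_cost (w (U p)) B p a = U p)"
    using p U[OF p(1,2)] action_cost_channel_sym[OF B, of "w (U p)" p] action_pmf_1
    by (auto simp: F_def)
  then show ?thesis
    using U_nonneg[OF p(1,2)] unfolding w_def m_def by blast
qed

text \<open>Well-founded recursion on the number of pending players chooses value and probability
  stage by stage, with \<open>{..<N}\<close> as the representative set of \<open>N\<close>
  opponents.\<close>

lemma ex_stage_values:
  "\<exists>V p. (\<forall>m. 0 \<le> V m) \<and>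
     (\<forall>B a. finite B \<longrightarrow> a \<in> {0, 1, 2} \<longrightarrow>
        V (Suc (card B)) \<le> action_cost V B (p (Suc (card B))) a \<and>
        (a \<in> set_pmf (action_pmf (p (Suc (card B)))) \<longrightarrow>
          action_cost V B (p (Suc (card B))) a = V (Suc (card B))))"
proof -
  \<comment> \<open>The truncation at \<open>m\<close> makes \<open>Q f m\<close> depend on
    \<open>f\<close> only below \<open>m\<close>, as dependent choice requires. For
    \<open>m = 0\<close> only nonnegativity is asked, since a pending player counts herself.\<close>
  define Q where "Q = (\<lambda>(f :: nat \<Rightarrow> real \<times> real) m (r, p). 0 \<le> r \<and> (\<forall>N. m = Suc N \<longrightarrow>
     (\<forall>a\<in>{0, 1, 2}.
       r \<le> action_cost (\<lambda>c. if c < m then fst (f c) else r) {..<N} p a \<and>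
       (a \<in> set_pmf (action_pmf p) \<longrightarrow>
         action_cost (\<lambda>c. if c < m then fst (f c) else r) {..<N} p a = r))))"
  have "\<exists>f. \<forall>m. Q f m (f m)"
  proof (rule dependent_wf_choice[OF wf_less])
    fix f g :: "nat \<Rightarrow> real \<times> real" and m r
    assume "\<And>z. (z, m) \<in> {(x, y). x < y} \<Longrightarrow> f z = g z"
    then have eq: "(\<lambda>c. if c < m then fst (f c) else x) = (\<lambda>c. if c < m then fst (g c) else x)" for x
      by auto
    show "Q f m r = Q g m r"
      by (cases r) (simp only: Q_def case_prod_conv eq)
  next
    fix m and f :: "nat \<Rightarrow> real \<times> real"
    assume *: "\<And>y. (y, m) \<in> {(x, y). x < y} \<Longrightarrow> Q f y (f y)"
    then have nonneg: "0 \<le> fst (f c)" if "c < m" for c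
      using *[of c] that by (cases "f c") (simp add: Q_def)
    show "\<exists>r. Q f m r"
    proof (cases m)
      case 0
      then show ?thesis by (auto simp: Q_def)
    next
      case (Suc N)
      then show ?thesis
        using ex_stage_equilibrium[of "{..<N}" "\<lambda>c. fst (f c)"] nonneg
        by (simp add: Q_def)
    qed
  qed
  then obtain f where f: "\<And>m. Q f m (f m)"
    by blast
  define V where "V = (\<lambda>m. fst (f m))"
  define p where "p = (\<lambda>m. snd (f m))"
  have fst_V: "fst (f m) = V m" for m
    by (simp add: V_def)
  have Q: "Q f m (V m, p m)" for m
    using f[of m] by (simp add: V_def p_def)
  have "V (Suc (card B)) \<le> action_cost V B (p (Suc (card B))) a \<and>
        (a \<in> set_pmf (action_pmf (p (Suc (card B)))) \<longrightarrow>
          action_cost V B (p (Suc (card B))) a = V (Suc (card B)))"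
    if "finite B" "a \<in> {0, 1, 2}" for B a
  proof -
    define m where "m = Suc (card B)"
    have "action_cost (\<lambda>c. if c < m then V c else V m) {..<card B} (p m) a =
        action_cost V {..<card B} (p m) a"
      by (rule action_cost_cong) (auto simp: m_def less_Suc_eq_le le_Suc_eq)
    also have "\<dots> = action_cost V B (p m) a"
      using that(1) by (intro action_cost_card) auto
    finally have "action_cost (\<lambda>c. if c < m then V c else V m) {..<card B} (p m) a =
        action_cost V B (p m) a" .
    then show ?thesis
      using Q[of m] that(2) unfolding Q_def case_prod_conv fst_V m_def by metis
  qed
  moreover have "0 \<le> V m" for m
    using Q[of m] by (simp add: Q_def)
  ultimately show ?thesis
    by blast
qed

section \<open>From the stage cost to one step of the game\<close>

text \<open>The candidate for the expected number of remaining slots. It sees a state only through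
  the number of pending players, so deviations can be compared state by state.\<close>

definition state_cost :: "(nat \<Rightarrow> real) \<Rightarrow> nat \<Rightarrow> nat \<Rightarrow> gstate \<Rightarrow> ennreal" where
  "state_cost v n i f = (if f i = None then 0 else ennreal (v (card (pending n f))))"

text \<open>Player \<open>i\<close> acts independently of the others, who all follow
  \<open>action_pmf p\<close> whatever their histories; integrating over their profile first leaves
  the stage cost of her action. Subtracting 1 removes the current slot, which
  \<open>action_cost\<close> includes.\<close>

lemma nn_integral_step:
  assumes v: "\<And>c. 0 \<le> v c" and i: "i < n" and f: "f i = Some h"
    and B: "B = pending n f - {i}" and m: "m = card (pending n f)"
    and P: "\<And>h. P h m = action_pmf p"
  shows "(\<integral>\<^sup>+g. state_cost v n i g \<partial>measure_pmf (step n ((\<lambda>_. P)(i := \<tau>)) f)) =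
         (\<integral>\<^sup>+a. ennreal (action_cost v B p a - 1) \<partial>measure_pmf (\<tau> h m))"
proof -
  define A where "A = pending n f"
  have A: "A = insert i B" "i \<notin> B" "finite B" "\<And>j. j \<in> A \<Longrightarrow> j < n"
    using i f unfolding A_def B by (auto simp: pending_def)
  define G where "G = (\<lambda>x j. if j \<in> A then
      (if x j \<noteq> 0 \<and> (\<forall>j'\<in>A. j' \<noteq> j \<longrightarrow> x j' \<noteq> x j) then None else Some (the (f j) @ [(m, x j)]))
      else None)"
  \<comment> \<open>\<open>y(i := a)\<close> is the joint action. If \<open>i\<close> is blocked,
    the players pending afterwards are \<open>i\<close> and those in \<open>remaining B a y\<close>;
    otherwise she has left and the cost is 0.\<close>
  have G: "state_cost v n i (G (y(i := a))) = ennreal (future_cost v B a y)" for y a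
  proof (cases "blocked B a y")
    case True
    have "pending n (G (y(i := a))) = {j\<in>A. (y(i := a)) j = 0 \<or> (\<exists>j'\<in>A. j' \<noteq> j \<and> (y(i := a)) j' = (y(i := a)) j)}"
      using A(4) by (auto simp: pending_def G_def split: if_splits)
    also have "\<dots> = insert i (remaining B a y)"
    proof (rule set_eqI)
      fix j
      consider "j = i" | "j \<in> B" "j \<noteq> i" | "j \<notin> A"
        using A(1) by blast
      then show "j \<in> {j\<in>A. (y(i := a)) j = 0 \<or> (\<exists>j'\<in>A. j' \<noteq> j \<and> (y(i := a)) j' = (y(i := a)) j)} \<longleftrightarrow>
          j \<in> insert i (remaining B a y)"
      proof cases
        case 1
        then show ?thesis
          using True A(2) unfolding A(1) blocked_def by fastforce
      next
        case 2
        then have "(\<exists>j'\<in>A. j' \<noteq> j \<and> (y(i := a)) j' = y j) \<longleftrightarrow>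
            a = y j \<or> (\<exists>j'\<in>B. j' \<noteq> j \<and> y j' = y j)"
          using A(2) unfolding A(1) by (metis fun_upd_apply insert_iff)
        with 2 show ?thesis
          by (auto simp: A(1) remaining_def)
      next
        case 3
        then show ?thesis
          by (simp add: A(1) remaining_def)
      qed
    qed
    finally have "card (pending n (G (y(i := a)))) = Suc (card (remaining B a y))"
      using A(2,3) by (simp add: remaining_def)
    moreover have "G (y(i := a)) i = Some (h @ [(m, a)])"
      using True A(2) f by (auto simp: G_def A(1) blocked_def)
    ultimately show ?thesis
      using True by (simp add: state_cost_def future_cost_def)
  next
    case False
    then have "G (y(i := a)) i = None"
      using A(2) by (auto simp: G_def A(1) blocked_def)
    then show ?thesis
      using False by (simp add: state_cost_def future_cost_def)
  qed
  have "step n ((\<lambda>_. P)(i := \<tau>)) f =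
      map_pmf G (Pi_pmf A 0 (\<lambda>j. ((\<lambda>_. P)(i := \<tau>)) j (the (f j)) m))"
    by (simp only: step_def Let_def G_def A_def m)
  also have "Pi_pmf A 0 (\<lambda>j. ((\<lambda>_. P)(i := \<tau>)) j (the (f j)) m) =
      Pi_pmf A 0 (\<lambda>j. if j = i then \<tau> h m else action_pmf p)"
    by (intro Pi_pmf_cong) (auto simp: f P)
  also have "\<dots> = map_pmf (\<lambda>(a, y). y(i := a)) (pair_pmf (\<tau> h m)
      (Pi_pmf B 0 (\<lambda>j. if j = i then \<tau> h m else action_pmf p)))"
    unfolding A(1) by (subst Pi_pmf_insert[OF A(3,2)]) simp
  also have "Pi_pmf B 0 (\<lambda>j. if j = i then \<tau> h m else action_pmf p) =
      Pi_pmf B 0 (\<lambda>_. action_pmf p)"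
    using A(2) by (intro Pi_pmf_cong) auto
  finally have "step n ((\<lambda>_. P)(i := \<tau>)) f =
      map_pmf G (map_pmf (\<lambda>(a, y). y(i := a)) (pair_pmf (\<tau> h m) (Pi_pmf B 0 (\<lambda>_. action_pmf p))))" .
  then have "(\<integral>\<^sup>+g. state_cost v n i g \<partial>measure_pmf (step n ((\<lambda>_. P)(i := \<tau>)) f)) =
     (\<integral>\<^sup>+a. \<integral>\<^sup>+y. ennreal (future_cost v B a y)
        \<partial>measure_pmf (Pi_pmf B 0 (\<lambda>_. action_pmf p)) \<partial>measure_pmf (\<tau> h m))"
    by (simp add: nn_integral_pair_pmf' G)
  moreover have "(\<integral>\<^sup>+y. ennreal (future_cost v B a y) \<partial>measure_pmf (Pi_pmf B 0 (\<lambda>_. action_pmf p))) =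
      ennreal (action_cost v B p a - 1)" for a
    using v A(3) unfolding action_cost_def
    by (subst nn_integral_eq_integral)
       (auto simp: future_cost_def intro!: integrable_measure_pmf_finite finite_set_profiles)
  ultimately show ?thesis
    by simp
qed

section \<open>Telescoping along a run\<close>

lemma step_absorbing: "f i = None \<Longrightarrow> g \<in> set_pmf (step n \<sigma> f) \<Longrightarrow> g i = None"
  by (auto simp: step_def Let_def pending_def)

lemma nn_integral_run_Suc:
  "(\<integral>\<^sup>+g. W g \<partial>measure_pmf (run n \<sigma> (Suc t) f)) =
   (\<integral>\<^sup>+g. \<integral>\<^sup>+g'. W g' \<partial>measure_pmf (step n \<sigma> g) \<partial>measure_pmf (run n \<sigma> t f))"
  by simp

lemma prob_pending_eq_nn_integral:
  "ennreal (measure_pmf.prob M {g. g i \<noteq> None}) =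
   (\<integral>\<^sup>+g. of_bool (g i \<noteq> None) \<partial>measure_pmf M)"
proof -
  have "(\<integral>\<^sup>+g. of_bool (g i \<noteq> None) \<partial>measure_pmf M) = (\<integral>\<^sup>+g. indicator {g. g i \<noteq> None} g \<partial>measure_pmf M)"
    by (intro nn_integral_cong) (auto simp: indicator_def)
  then show ?thesis
    by (simp add: measure_pmf.emeasure_eq_measure)
qed

lemma exp_remaining_le:
  assumes "\<And>g. of_bool (g i \<noteq> None) + (\<integral>\<^sup>+g'. W g' \<partial>measure_pmf (step n \<sigma> g)) \<le> W g"
  shows "exp_remaining n \<sigma> i f \<le> W f"
proof -
  have "(\<Sum>u<t. ennreal (measure_pmf.prob (run n \<sigma> u f) {g. g i \<noteq> None})) +
      (\<integral>\<^sup>+g. W g \<partial>measure_pmf (run n \<sigma> t f)) \<le> W f" for t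
  proof (induction t)
    case (Suc t)
    have "ennreal (measure_pmf.prob (run n \<sigma> t f) {g. g i \<noteq> None}) +
        (\<integral>\<^sup>+g. W g \<partial>measure_pmf (run n \<sigma> (Suc t) f)) \<le> (\<integral>\<^sup>+g. W g \<partial>measure_pmf (run n \<sigma> t f))"
      unfolding prob_pending_eq_nn_integral nn_integral_run_Suc
      by (subst nn_integral_add[symmetric]) (simp, simp, rule nn_integral_mono, rule assms)
    then show ?case
      using Suc by (simp del: run.simps add: add.assoc) (meson add_left_mono order_trans)
  qed simp
  then have "(\<Sum>u<t. ennreal (measure_pmf.prob (run n \<sigma> u f) {g. g i \<noteq> None})) \<le> W f" for t
    using order_trans[OF le_iff_add[THEN iffD2]] by blast
  then show ?thesis
    unfolding exp_remaining_def by (intro suminf_le_const) auto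
qed

text \<open>Here the expectation of \<open>W\<close> after \<open>t\<close> slots must vanish in the
  limit. It is at most \<open>C\<close> times the probability of being still pending, which tends to
  0 as the general term of a convergent series; if the series diverges, the claim is
  trivial.\<close>

lemma le_exp_remaining:
  assumes W: "\<And>g. W g \<le> of_bool (g i \<noteq> None) + (\<integral>\<^sup>+g'. W g' \<partial>measure_pmf (step n \<sigma> g))"
    and C: "\<And>g. W g \<le> ennreal C * of_bool (g i \<noteq> None)"
  shows "W f \<le> exp_remaining n \<sigma> i f"
proof (cases "exp_remaining n \<sigma> i f = top")
  case False
  define q where "q = (\<lambda>t. measure_pmf.prob (run n \<sigma> t f) {g. g i \<noteq> None})"
  have E: "exp_remaining n \<sigma> i f = (\<Sum>t. ennreal (q t))"
    by (simp add: exp_remaining_def q_def)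
  have "W f \<le> (\<Sum>u<t. ennreal (q u)) + (\<integral>\<^sup>+g. W g \<partial>measure_pmf (run n \<sigma> t f))" for t
  proof (induction t)
    case (Suc t)
    have "(\<integral>\<^sup>+g. W g \<partial>measure_pmf (run n \<sigma> t f)) \<le>
        ennreal (q t) + (\<integral>\<^sup>+g. W g \<partial>measure_pmf (run n \<sigma> (Suc t) f))"
      unfolding q_def prob_pending_eq_nn_integral nn_integral_run_Suc
      by (subst nn_integral_add[symmetric]) (simp, simp, rule nn_integral_mono, rule W)
    then show ?case
      using Suc by (simp del: run.simps add: add.assoc) (meson add_left_mono order_trans)
  qed simp
  also have "(\<Sum>u<t. ennreal (q u)) + (\<integral>\<^sup>+g. W g \<partial>measure_pmf (run n \<sigma> t f)) \<le>
      exp_remaining n \<sigma> i f + ennreal C * ennreal (q t)" for t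
  proof (rule add_mono)
    show "(\<Sum>u<t. ennreal (q u)) \<le> exp_remaining n \<sigma> i f"
      unfolding E by (rule sum_le_suminf) auto
    show "(\<integral>\<^sup>+g. W g \<partial>measure_pmf (run n \<sigma> t f)) \<le> ennreal C * ennreal (q t)"
      unfolding q_def prob_pending_eq_nn_integral
      by (subst nn_integral_cmult[symmetric]) (simp, rule nn_integral_mono, rule C)
  qed
  finally have le: "W f \<le> exp_remaining n \<sigma> i f + ennreal C * ennreal (q t)" for t .
  have "summable q"
    using False unfolding E by (intro summable_suminf_not_top) (auto simp: q_def)
  then have "(\<lambda>t. ennreal (q t)) \<longlonglongrightarrow> ennreal 0"
    by (intro tendsto_ennrealI summable_LIMSEQ_zero)
  then have "(\<lambda>t. exp_remaining n \<sigma> i f + ennreal C * ennreal (q t)) \<longlonglongrightarrow>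
      exp_remaining n \<sigma> i f + ennreal C * ennreal 0"
    by (intro tendsto_add tendsto_const ennreal_tendsto_cmult) auto
  then show ?thesis
    using le by (intro LIMSEQ_le_const) (auto simp: ennreal_0)
qed simp

section \<open>Optimality of the memoryless protocol against all deviations\<close>

theorem theorem5:
  fixes n :: nat
  shows "\<exists>P :: rule. equilibrium_protocol 2 n P"
proof -
  obtain V p where V: "\<And>m. 0 \<le> V m"
    and Vp: "\<And>B a. finite B \<Longrightarrow> a \<in> {0, 1, 2} \<Longrightarrow>
      V (Suc (card B)) \<le> action_cost V B (p (Suc (card B))) a \<and>
      (a \<in> set_pmf (action_pmf (p (Suc (card B)))) \<longrightarrow>
        action_cost V B (p (Suc (card B))) a = V (Suc (card B)))"
    using ex_stage_values by metis
  have V_le: "V (Suc (card B)) \<le> action_cost V B (p (Suc (card B))) a"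
    if "finite B" "a \<in> {0, 1, 2}" for B a
    using Vp[OF that] by (rule conjunct1)
  have V_eq: "action_cost V B (p (Suc (card B))) a = V (Suc (card B))"
    if "finite B" "a \<in> set_pmf (action_pmf (p (Suc (card B))))" for B a
    using Vp[OF that(1) subsetD[OF set_action_pmf that(2)]] that(2) by simp
  define P :: rule where "P = (\<lambda>h m. action_pmf (p m))"
  have valid: "valid_rule 2 P"
    using set_action_pmf by (force simp: valid_rule_def P_def)
  define W where "W = state_cost V n"
  \<comment> \<open>The Bellman inequality holds for every valid \<open>\<tau>\<close>, since its
    actions lie in \<open>{0, 1, 2}\<close>. The reverse inequality holds for \<open>P\<close>,
    whose support contains only actions of cost \<open>V m\<close>.\<close>
  have one_step: "W i g \<le> of_bool (g i \<noteq> None) +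
        (\<integral>\<^sup>+g'. W i g' \<partial>measure_pmf (step n ((\<lambda>_. P)(i := \<tau>)) g))"
      "\<tau> = P \<Longrightarrow> of_bool (g i \<noteq> None) +
        (\<integral>\<^sup>+g'. W i g' \<partial>measure_pmf (step n ((\<lambda>_. P)(i := \<tau>)) g)) \<le> W i g"
    if i: "i < n" and \<tau>: "valid_rule 2 \<tau>" for i \<tau> g
  proof -
    have "W i g \<le> of_bool (g i \<noteq> None) +
        (\<integral>\<^sup>+g'. W i g' \<partial>measure_pmf (step n ((\<lambda>_. P)(i := \<tau>)) g)) \<and>
      (\<tau> = P \<longrightarrow> of_bool (g i \<noteq> None) +
        (\<integral>\<^sup>+g'. W i g' \<partial>measure_pmf (step n ((\<lambda>_. P)(i := \<tau>)) g)) \<le> W i g)"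
    proof (cases "g i")
      case None
      then have "(\<integral>\<^sup>+g'. W i g' \<partial>measure_pmf (step n ((\<lambda>_. P)(i := \<tau>)) g)) = 0"
        by (subst nn_integral_0_iff_AE)
           (auto simp: AE_measure_pmf_iff W_def state_cost_def dest: step_absorbing)
      with None show ?thesis
        by (auto simp: W_def state_cost_def)
    next
      case (Some h)
      define B where "B = pending n g - {i}"
      have "i \<in> pending n g" "finite (pending n g)"
        using i Some by (auto simp: pending_def)
      then have B: "finite B" "card (pending n g) = Suc (card B)"
        by (simp_all only: B_def finite_Diff card.remove)
      define m where "m = Suc (card B)"
      define c where "c = action_cost V B (p m)"
      have "(\<integral>\<^sup>+g'. W i g' \<partial>measure_pmf (step n ((\<lambda>_. P)(i := \<tau>)) g)) =
         (\<integral>\<^sup>+a. ennreal (c a - 1) \<partial>measure_pmf (\<tau> h m))"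
        unfolding W_def c_def using i Some B(2) V
        by (intro nn_integral_step) (auto simp: B_def m_def P_def)
      moreover have "1 + (\<integral>\<^sup>+a. ennreal (c a - 1) \<partial>measure_pmf (\<tau> h m)) =
         (\<integral>\<^sup>+a. ennreal (c a) \<partial>measure_pmf (\<tau> h m))"
      proof -
        \<comment> \<open>\<open>ennreal\<close> sends negative reals to 0, so the slot taken off in
          \<open>c a - 1\<close> can be added back only because \<open>1 \<le> c a\<close>.\<close>
        have "1 \<le> c a" for a
          unfolding c_def action_cost_def
          by (simp add: Bochner_Integration.integral_nonneg future_cost_def V)
        then have "ennreal (c a) = 1 + ennreal (c a - 1)" for a
          by (subst ennreal_1[symmetric], subst ennreal_plus[symmetric]) auto
        then show ?thesis
          by (simp add: nn_integral_add measure_pmf.emeasure_space_1)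
      qed
      moreover have "W i g = (\<integral>\<^sup>+a. ennreal (V m) \<partial>measure_pmf (\<tau> h m))"
        using Some B(2) by (simp add: W_def state_cost_def m_def)
      moreover have "(\<integral>\<^sup>+a. ennreal (V m) \<partial>measure_pmf (\<tau> h m)) \<le>
          (\<integral>\<^sup>+a. ennreal (c a) \<partial>measure_pmf (\<tau> h m))"
      proof (rule nn_integral_mono_AE)
        have "set_pmf (\<tau> h m) \<subseteq> {0, 1, 2}"
          using \<tau> by (force simp: valid_rule_def)
        then show "AE a in measure_pmf (\<tau> h m). ennreal (V m) \<le> ennreal (c a)"
          using V_le[OF B(1)] by (auto simp: AE_measure_pmf_iff c_def m_def intro!: ennreal_leI)
      qed
      moreover have "(\<integral>\<^sup>+a. ennreal (c a) \<partial>measure_pmf (P h m)) =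
          (\<integral>\<^sup>+a. ennreal (V m) \<partial>measure_pmf (P h m))"
        by (rule nn_integral_cong_AE)
           (use V_eq[OF B(1)] in \<open>auto simp: AE_measure_pmf_iff c_def m_def P_def\<close>)
      ultimately show ?thesis
        using Some by auto
    qed
    then show "W i g \<le> of_bool (g i \<noteq> None) +
        (\<integral>\<^sup>+g'. W i g' \<partial>measure_pmf (step n ((\<lambda>_. P)(i := \<tau>)) g))"
      "\<tau> = P \<Longrightarrow> of_bool (g i \<noteq> None) +
        (\<integral>\<^sup>+g'. W i g' \<partial>measure_pmf (step n ((\<lambda>_. P)(i := \<tau>)) g)) \<le> W i g"
      by auto
  qed
  \<comment> \<open>At most \<open>n\<close> players are pending, and a sum of nonnegative values
    dominates each of them, which gives the uniform constant for
    \<open>le_exp_remaining\<close>.\<close>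
  have W_bound: "W i g \<le> ennreal (\<Sum>m\<le>n. V m) * of_bool (g i \<noteq> None)" for i g
  proof -
    have "card (pending n g) \<le> card {..<n}"
      by (intro card_mono) (auto simp: pending_def)
    then have "V (card (pending n g)) \<le> (\<Sum>m\<le>n. V m)"
      using V by (intro member_le_sum) auto
    then show ?thesis
      by (auto simp: W_def state_cost_def intro!: ennreal_leI)
  qed
  have "exp_remaining n ((\<lambda>_. P)(i := P)) i f \<le> exp_remaining n ((\<lambda>_. P)(i := \<tau>)) i f"
    if "i < n" "valid_rule 2 \<tau>" for i \<tau> f
    using exp_remaining_le[where i = i and W = "W i", OF one_step(2)[OF that(1) valid refl]]
      le_exp_remaining[where i = i and W = "W i", OF one_step(1)[OF that] W_bound]
    by (rule order_trans)
  \<comment> \<open>The law of the state reached and the conditioning event are the same for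
    \<open>P\<close> and \<open>\<tau>\<close>, so the inequality for each state passes through the
    integral and the normalisation.\<close>
  then have "cond_exp_latency n P i h m P \<le> cond_exp_latency n P i h m \<tau>"
    if "i < n" "valid_rule 2 \<tau>" for i \<tau> h m
    unfolding cond_exp_latency_def using that
    by (intro divide_right_mono_ennreal nn_integral_mono mult_left_mono add_left_mono) auto
  with valid show ?thesis
    unfolding equilibrium_protocol_def by blast
qed

end
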